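(* Let $(D,\sqsubseteq)$ be a finite partial ordering with least element $\bot$ and greatest element $\top$, and let $F$ be a finite set of functions $D\to D$, each inflationary and monotonic. Suppose that for each $g\in F$ and $d\in D$ two lists $\mathit{friends}(g,d)$ and $\mathit{obviated}(g,d)$ of functions from $F$ are given such that the following condition ( * ) holds: for every $g\in F$ and every $d\in D$, writing $\mathit{friends}(g,d)=[g_1,\ldots,g_k]$, for every $e$ with $g\circ g_1\circ\cdots\circ g_k(d)\sqsubseteq e$ and every $f\in \mathit{friends}(g,d)\cup\mathit{obviated}(g,d)$ we have $f(e)=e$. Then every execution of the Revised Generic Iteration Algorithm (RGI) described in the context terminates, and upon termination $d$ equals the least common fixpoint of the functions in the original set $F$ (the value $F_0$).
   Context: A function $f:D\to D$ is inflationary if $x\sqsubseteq f(x)$ for all $x$, and monotonic if $x\sqsubseteq y$ implies $f(x)\sqsubseteq f(y)$. Revised Generic Iteration Algorithm (RGI): $d:=\bot$; $F_0:=F$; $G:=F$; while $G\neq\emptyset$ and $d\neq\top$ do: choose $g\in G$; $G:=G-\{g\}$; $F:=F-(\mathit{friends}(g,d)\cup\mathit{obviated}(g,d))$; $G:=G-(\mathit{friends}(g,d)\cup\mathit{obviated}(g,d))$; $G:=G\cup\mathit{update}(G,h,d)$, where $\mathit{friends}(g,d)=[g_1,\ldots,g_k]$ and $h=g\circ g_1\circ\cdots\circ g_k$; $d:=h(d)$; end. (The lists are identified with sets where set operations are used.) Here $\mathit{update}(G,h,d)$ is a subset of the current set $F$ satisfying, for all $G,h,d$: (A) $\{f\in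 F-G \mid f(d)=d \wedge f(h(d))\neq h(d)\}\subseteq \mathit{update}(G,h,d)$; (B) $h(d)=d$ implies $\mathit{update}(G,h,d)=\emptyset$; (C) $h(h(d))\neq h(d)$ implies $h\in\mathit{update}(G,h,d)$. *)

theory Defs
  imports Main
begin

definition inflationary :: "('a::order \<Rightarrow> 'a) \<Rightarrow> bool" where
  "inflationary f \<longleftrightarrow> (\<forall>x. x \<le> f x)"

definition least_common_fixpoint :: "('a::order \<Rightarrow> 'a) set \<Rightarrow> 'a \<Rightarrow> bool" where
  "least_common_fixpoint F d \<longleftrightarrow>
     (\<forall>f\<in>F. f d = d) \<and> (\<forall>e. (\<forall>f\<in>F. f e = e) \<longrightarrow> d \<le> e)"

(* compose [g1, ..., gk] = g1 o ... o gk; in particular gk is applied first. *)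
definition compose :: "('a \<Rightarrow> 'a) list \<Rightarrow> 'a \<Rightarrow> 'a" where
  "compose gs = foldr (\<circ>) gs id"

definition friends_condition ::
  "('a::order \<Rightarrow> 'a) set \<Rightarrow> (('a \<Rightarrow> 'a) \<Rightarrow> 'a \<Rightarrow> ('a \<Rightarrow> 'a) list) \<Rightarrow>
   (('a \<Rightarrow> 'a) \<Rightarrow> 'a \<Rightarrow> ('a \<Rightarrow> 'a) list) \<Rightarrow> bool" where
  "friends_condition F friends obviated \<longleftrightarrow>
     (\<forall>g\<in>F. \<forall>d e. compose (g # friends g d) d \<le> e \<longrightarrow>
        (\<forall>f \<in> set (friends g d) \<union> set (obviated g d). f e = e))"

(* The requirements on the value U of update(G, h, d), where F is the current
   value of the program variable F. *)
definition update_spec ::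
  "('a \<Rightarrow> 'a) set \<Rightarrow> ('a \<Rightarrow> 'a) set \<Rightarrow> ('a \<Rightarrow> 'a) \<Rightarrow> 'a \<Rightarrow> ('a \<Rightarrow> 'a) set \<Rightarrow> bool" where
  "update_spec F G h d U \<longleftrightarrow>
     U \<subseteq> F \<and>
     {f \<in> F - G. f d = d \<and> f (h d) \<noteq> h d} \<subseteq> U \<and>
     (h d = d \<longrightarrow> U = {}) \<and>
     (h (h d) \<noteq> h d \<longrightarrow> h \<in> U)"

(* A state (F, G, d) holds the values of the program variables at the loop test. *)
type_synonym 'a rgi_state = "('a \<Rightarrow> 'a) set \<times> ('a \<Rightarrow> 'a) set \<times> 'a"

fun rgi_guard :: "'a::order_top rgi_state \<Rightarrow> bool" where
  "rgi_guard (F, G, d) \<longleftrightarrow> G \<noteq> {} \<and> d \<noteq> top"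

definition rgi_init :: "('a::order_bot \<Rightarrow> 'a) set \<Rightarrow> 'a rgi_state" where
  "rgi_init F = (F, F, bot)"

(* The values of F, G and h in the loop body at the point where update is called,
   when g was chosen in state (F, G, d); d still has its old value there. *)
definition rgi_F ::
  "(('a \<Rightarrow> 'a) \<Rightarrow> 'a \<Rightarrow> ('a \<Rightarrow> 'a) list) \<Rightarrow> (('a \<Rightarrow> 'a) \<Rightarrow> 'a \<Rightarrow> ('a \<Rightarrow> 'a) list) \<Rightarrow>
   ('a \<Rightarrow> 'a) \<Rightarrow> ('a \<Rightarrow> 'a) set \<Rightarrow> 'a \<Rightarrow> ('a \<Rightarrow> 'a) set" where
  "rgi_F friends obviated g F d = F - (set (friends g d) \<union> set (obviated g d))"

definition rgi_G ::
  "(('a \<Rightarrow> 'a) \<Rightarrow> 'a \<Rightarrow> ('a \<Rightarrow> 'a) list) \<Rightarrow> (('a \<Rightarrow> 'a) \<Rightarrow> 'a \<Rightarrow> ('a \<Rightarrow> 'a) list) \<Rightarrow>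
   ('a \<Rightarrow> 'a) \<Rightarrow> ('a \<Rightarrow> 'a) set \<Rightarrow> 'a \<Rightarrow> ('a \<Rightarrow> 'a) set" where
  "rgi_G friends obviated g G d = (G - {g}) - (set (friends g d) \<union> set (obviated g d))"

definition rgi_h ::
  "(('a \<Rightarrow> 'a) \<Rightarrow> 'a \<Rightarrow> ('a \<Rightarrow> 'a) list) \<Rightarrow> ('a \<Rightarrow> 'a) \<Rightarrow> 'a \<Rightarrow> 'a \<Rightarrow> 'a" where
  "rgi_h friends g d = compose (g # friends g d)"

(* One iteration of the loop. The choice of g is nondeterministic. The value of
   update may depend on the current F, which is therefore its first argument. *)
inductive rgi_step ::
  "(('a::order_top \<Rightarrow> 'a) \<Rightarrow> 'a \<Rightarrow> ('a \<Rightarrow> 'a) list) \<Rightarrow> (('a \<Rightarrow> 'a) \<Rightarrow> 'a \<Rightarrow> ('a \<Rightarrow> 'a) list) \<Rightarrow>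
   (('a \<Rightarrow> 'a) set \<Rightarrow> ('a \<Rightarrow> 'a) set \<Rightarrow> ('a \<Rightarrow> 'a) \<Rightarrow> 'a \<Rightarrow> ('a \<Rightarrow> 'a) set) \<Rightarrow>
   'a rgi_state \<Rightarrow> 'a rgi_state \<Rightarrow> bool"
  for friends obviated update where
  "\<lbrakk> rgi_guard (F, G, d); g \<in> G;
     F' = rgi_F friends obviated g F d;
     G' = rgi_G friends obviated g G d;
     h = rgi_h friends g d \<rbrakk>
   \<Longrightarrow> rgi_step friends obviated update (F, G, d) (F', G' \<union> update F' G' h d, h d)"

(* update meets its specification at every call made in some execution started
   with F0. Demanding it for arbitrary values of F and h instead would be unsatisfiable
   in general, because the first and last conjuncts of update_spec force
   h to be an element of F whenever h (h d) differs from h d. *)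
definition update_correct ::
  "('a::{order_bot,order_top} \<Rightarrow> 'a) set \<Rightarrow>
   (('a \<Rightarrow> 'a) \<Rightarrow> 'a \<Rightarrow> ('a \<Rightarrow> 'a) list) \<Rightarrow> (('a \<Rightarrow> 'a) \<Rightarrow> 'a \<Rightarrow> ('a \<Rightarrow> 'a) list) \<Rightarrow>
   (('a \<Rightarrow> 'a) set \<Rightarrow> ('a \<Rightarrow> 'a) set \<Rightarrow> ('a \<Rightarrow> 'a) \<Rightarrow> 'a \<Rightarrow> ('a \<Rightarrow> 'a) set) \<Rightarrow> bool" where
  "update_correct F0 friends obviated update \<longleftrightarrow>
     (\<forall>F G d g. (rgi_step friends obviated update)\<^sup>*\<^sup>* (rgi_init F0) (F, G, d) \<longrightarrow>
        rgi_guard (F, G, d) \<longrightarrow> g \<in> G \<longrightarrow>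
        (let F' = rgi_F friends obviated g F d;
             G' = rgi_G friends obviated g G d;
             h = rgi_h friends g d
         in update_spec F' G' h d (update F' G' h d)))"

end

theory Submission
  imports Defs
begin

text \<open>
  Every iteration either strictly increases \<open>d\<close> or keeps \<open>d\<close> and shrinks \<open>G\<close>, hence termination.
  By monotonicity \<open>d\<close> stays below every common fixpoint, so it remains to see that the final \<open>d\<close> is
  one. If \<open>h\<close> is the composition formed in an iteration, the friends are the identity above \<open>h d\<close>, so
  \<open>h\<close> and the chosen \<open>g\<close> have the same fixpoints there. When \<open>h\<close> does not fix \<open>h d\<close>, condition (C) puts
  \<open>h\<close>, and not necessarily \<open>g\<close>, back into \<open>G\<close>; therefore \<open>f d = d\<close> may fail for a function
  \<open>f \<in> F - G\<close>. What is invariant is that every original function is dominated, as far as fixpoints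
  above \<open>d\<close> are concerned, by one that is in \<open>G\<close>, or is in \<open>F\<close> and fixes \<open>d\<close>, or is the identity
  above \<open>d\<close>.
\<close>

lemma compose_Nil [simp]: "compose [] x = x"
  by (simp add: compose_def)

lemma compose_Cons [simp]: "compose (g # gs) x = g (compose gs x)"
  by (simp add: compose_def)

lemma compose_inflationary:
  assumes "\<And>f. f \<in> set gs \<Longrightarrow> inflationary f"
  shows "x \<le> compose gs x"
  using assms by (induction gs) (auto simp: inflationary_def intro: order_trans)

lemma compose_fixpoint:
  assumes "\<And>f. f \<in> set gs \<Longrightarrow> f x = x"
  shows "compose gs x = x"
  using assms by (induction gs) auto

lemma compose_le_fixpoint:
  assumes "\<And>f. f \<in> set gs \<Longrightarrow> mono f" and "\<And>f. f \<in> set gs \<Longrightarrow> f e = e" and "d \<le> e"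
  shows "compose gs d \<le> e"
  using assms(1,2)
proof (induction gs)
  case Nil
  then show ?case using \<open>d \<le> e\<close> by simp
next
  case (Cons g gs)
  then have "g (compose gs d) \<le> g e" by (simp add: monoD)
  then show ?case using Cons.prems(2)[of g] by simp
qed

text \<open>Membership in \<open>F\<close> accompanies \<open>k d = d\<close> because condition (A)
  speaks only of functions in the current \<open>F\<close>. The last disjunct accounts for functions
  deleted from \<open>F\<close> as friends or obviated.\<close>

definition controlled :: "('a::order \<Rightarrow> 'a) set \<Rightarrow> ('a \<Rightarrow> 'a) set \<Rightarrow> 'a \<Rightarrow> ('a \<Rightarrow> 'a) \<Rightarrow> bool" where
  "controlled F G d k \<longleftrightarrow> k \<in> G \<or> (k \<in> F \<and> k d = d) \<or> (\<forall>e\<ge>d. k e = e)"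

text \<open>The witness \<open>k\<close> ranges over \<open>F0\<close> and not over the current
  \<open>F\<close>, so that a deleted function can still serve as witness.\<close>

definition rgi_invariant ::
  "('a::order \<Rightarrow> 'a) set \<Rightarrow> ('a \<Rightarrow> 'a) set \<Rightarrow> ('a \<Rightarrow> 'a) set \<Rightarrow> 'a \<Rightarrow> bool" where
  "rgi_invariant F0 F G d \<longleftrightarrow>
     G \<subseteq> F \<and> F \<subseteq> F0 \<and>
     (\<forall>e. (\<forall>f\<in>F0. f e = e) \<longrightarrow> d \<le> e) \<and>
     (\<forall>f\<in>F0. \<exists>k\<in>F0. controlled F G d k \<and> (\<forall>e\<ge>d. k e = e \<longrightarrow> f e = e))"

locale rgi =
  fixes F0 :: "('a::{finite,order_bot,order_top} \<Rightarrow> 'a) set"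
    and friends obviated :: "('a \<Rightarrow> 'a) \<Rightarrow> 'a \<Rightarrow> ('a \<Rightarrow> 'a) list"
    and update :: "('a \<Rightarrow> 'a) set \<Rightarrow> ('a \<Rightarrow> 'a) set \<Rightarrow> ('a \<Rightarrow> 'a) \<Rightarrow> 'a \<Rightarrow> ('a \<Rightarrow> 'a) set"
  assumes inflationary: "f \<in> F0 \<Longrightarrow> inflationary f"
    and mono: "f \<in> F0 \<Longrightarrow> mono f"
    and friends_subset: "g \<in> F0 \<Longrightarrow> set (friends g d) \<subseteq> F0"
    and friends_condition: "friends_condition F0 friends obviated"
    and update_correct: "update_correct F0 friends obviated update"
begin

abbreviation step :: "'a rgi_state \<Rightarrow> 'a rgi_state \<Rightarrow> bool" where
  "step \<equiv> rgi_step friends obviated update"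

lemma le_rgi_h: "g \<in> F0 \<Longrightarrow> x \<le> rgi_h friends g d x"
  unfolding rgi_h_def using inflationary friends_subset[of g d]
  by (intro compose_inflationary) auto

lemma removed_fixes:
  assumes "g \<in> F0" "f \<in> set (friends g d) \<union> set (obviated g d)" "rgi_h friends g d d \<le> e"
  shows "f e = e"
  using friends_condition assms unfolding friends_condition_def rgi_h_def by blast

lemma rgi_h_eq_above:
  assumes "g \<in> F0" "rgi_h friends g d d \<le> e"
  shows "rgi_h friends g d e = g e"
proof -
  have "compose (friends g d) e = e"
    using removed_fixes[OF assms(1) _ assms(2)] by (intro compose_fixpoint) blast
  then show ?thesis by (simp add: rgi_h_def)
qed

text \<open>The old witness \<open>k\<close> is kept unless it is the chosen \<open>g\<close> and
  \<open>h\<close> moves \<open>h d\<close>; then \<open>h\<close> takes over. Writing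
  \<open>insert k F0\<close> lets \<open>k\<close> be its own witness without assuming that it lies
  in \<open>F0\<close>.\<close>

lemma controlled_step:
  assumes sub: "G \<subseteq> F" "F \<subseteq> F0" and g: "g \<in> G" and k: "controlled F G d k"
    and F': "F' = rgi_F friends obviated g F d"
    and G': "G' = rgi_G friends obviated g G d"
    and h: "h = rgi_h friends g d"
    and U: "update_spec F' G' h d U"
  shows "\<exists>k'\<in>insert k F0. controlled F' (G' \<union> U) (h d) k' \<and> (\<forall>e\<ge>h d. k' e = e \<longrightarrow> k e = e)"
proof (cases "k \<in> set (friends g d) \<union> set (obviated g d)")
  case True
  then have "\<forall>e\<ge>h d. k e = e"
    using removed_fixes sub g h by blast
  then show ?thesis by (auto simp: controlled_def)
next
  case kept: False
  have gF0: "g \<in> F0" and dh: "d \<le> h d" using sub g le_rgi_h h by auto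
  consider "k = g" | "k \<in> G'" | "k \<in> F" "k \<notin> G'" "k d = d" | "\<forall>e\<ge>d. k e = e"
    using k kept unfolding controlled_def G' rgi_G_def by blast
  then show ?thesis
  proof cases
    case 1
    have gh: "h e = k e" if "h d \<le> e" for e
      using rgi_h_eq_above[OF gF0, of d e] that h 1 by simp
    show ?thesis
    proof (cases "h (h d) = h d")
      case True
      then have "k (h d) = h d" using gh[of "h d"] by simp
      moreover have "k \<in> F'" using kept 1 g sub F' unfolding rgi_F_def by blast
      ultimately show ?thesis by (auto simp: controlled_def)
    next
      case False
      \<comment> \<open>By (C) the update contains \<open>h\<close>, and its values lie in
        \<open>F'\<close>. Hence this composition is itself an original function and is admissible
        as a witness.\<close>
      then have "h \<in> U" "U \<subseteq> F'" using U by (auto simp: update_spec_def)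
      moreover have "F' \<subseteq> F0" using F' sub unfolding rgi_F_def by blast
      moreover have "\<forall>e\<ge>h d. h e = e \<longrightarrow> k e = e" using gh by simp
      ultimately show ?thesis unfolding controlled_def by blast
    qed
  next
    case 2
    then show ?thesis by (auto simp: controlled_def)
  next
    case 3
    then have "k \<in> F' - G'" using kept F' unfolding rgi_F_def by blast
    \<comment> \<open>Condition (A): a function of \<open>F'\<close> outside \<open>G'\<close> that
      fixes \<open>d\<close> is rescheduled if it moves \<open>h d\<close>.\<close>
    then have "k (h d) = h d \<or> k \<in> U" using U 3 unfolding update_spec_def by blast
    then show ?thesis using \<open>k \<in> F' - G'\<close> by (auto simp: controlled_def)
  next
    case 4
    then show ?thesis using order_trans[OF dh] unfolding controlled_def by blast
  qed
qed

lemma rgi_invariant_step: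
  assumes inv: "rgi_invariant F0 F G d" and g: "g \<in> G"
    and F': "F' = rgi_F friends obviated g F d"
    and G': "G' = rgi_G friends obviated g G d"
    and h: "h = rgi_h friends g d"
    and U: "update_spec F' G' h d U"
  shows "rgi_invariant F0 F' (G' \<union> U) (h d)"
proof -
  have sub: "G \<subseteq> F" "F \<subseteq> F0" using inv by (auto simp: rgi_invariant_def)
  then have gF0: "g \<in> F0" using g by blast
  have dh: "d \<le> h d" using gF0 le_rgi_h h by auto
  have "G' \<union> U \<subseteq> F'" "F' \<subseteq> F0"
    using sub U unfolding F' G' rgi_F_def rgi_G_def update_spec_def by blast+
  moreover have "h d \<le> e" if e: "\<forall>f\<in>F0. f e = e" for e
  proof -
    \<comment> \<open>Starting from \<open>d \<le> e\<close>, each factor of \<open>h\<close> is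
      monotone and fixes \<open>e\<close>, so the value stays below \<open>e\<close>.\<close>
    have "set (g # friends g d) \<subseteq> F0" using gF0 friends_subset by simp
    moreover have "d \<le> e" using inv e by (simp add: rgi_invariant_def)
    ultimately show ?thesis
      unfolding h rgi_h_def using e mono by (intro compose_le_fixpoint) blast+
  qed
  moreover have "\<exists>k\<in>F0. controlled F' (G' \<union> U) (h d) k \<and> (\<forall>e\<ge>h d. k e = e \<longrightarrow> f e = e)"
    if f: "f \<in> F0" for f
  proof -
    obtain k where k: "k \<in> F0" "controlled F G d k" "\<forall>e\<ge>d. k e = e \<longrightarrow> f e = e"
      using inv f unfolding rgi_invariant_def by blast
    obtain k' where k': "k' \<in> F0" "controlled F' (G' \<union> U) (h d) k'"
      "\<forall>e\<ge>h d. k' e = e \<longrightarrow> k e = e"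
      using controlled_step[OF sub g k(2) F' G' h U] unfolding insert_absorb[OF k(1)] by blast
    have "\<forall>e\<ge>h d. k' e = e \<longrightarrow> f e = e" using k(3) k'(3) order_trans[OF dh] by simp
    with k' show ?thesis by blast
  qed
  ultimately show ?thesis unfolding rgi_invariant_def by simp
qed

text \<open>The specification of \<open>update\<close> is assumed only for calls made in executions
  from \<open>F0\<close>, hence the reachability premise.\<close>

lemma rgi_stepE:
  assumes "step\<^sup>*\<^sup>* (rgi_init F0) (F, G, d)" "step (F, G, d) s"
  obtains g F' G' h U where "g \<in> G" "F' = rgi_F friends obviated g F d"
    "G' = rgi_G friends obviated g G d" "h = rgi_h friends g d"
    "update_spec F' G' h d U" "s = (F', G' \<union> U, h d)"
  using assms(2)
proof cases
  case (1 g F' G' h)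
  have "update_spec F' G' h d (update F' G' h d)"
    using update_correct assms(1) 1 unfolding update_correct_def Let_def by blast
  with 1 that show thesis by blast
qed

lemma rgi_invariant_init: "rgi_invariant F0 F0 F0 bot"
  unfolding rgi_invariant_def controlled_def using bot_least by blast

lemma rgi_invariant_reachable:
  assumes "step\<^sup>*\<^sup>* (rgi_init F0) (F, G, d)"
  shows "rgi_invariant F0 F G d"
proof -
  have "case s of (F, G, d) \<Rightarrow> rgi_invariant F0 F G d" if "step\<^sup>*\<^sup>* (rgi_init F0) s" for s
    using that
  proof (induction rule: rtranclp_induct)
    case base
    then show ?case by (simp add: rgi_init_def rgi_invariant_init)
  next
    case (step s t)
    obtain F G d where s: "s = (F, G, d)" by (cases s)
    from step have "step\<^sup>*\<^sup>* (rgi_init F0) (F, G, d)" "step (F, G, d) t" by (simp_all add: s)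
    then show ?case
    proof (cases rule: rgi_stepE)
      case (1 g F' G' h U)
      then show ?thesis using rgi_invariant_step[of F G d] step.IH s by simp
    qed
  qed
  with assms show ?thesis by blast
qed

lemma rgi_step_decreases:
  assumes reach: "step\<^sup>*\<^sup>* (rgi_init F0) (F, G, d)" and "step (F, G, d) (F', G', d')"
  shows "d < d' \<or> (d' = d \<and> G' \<subset> G)"
  using assms
proof (cases rule: rgi_stepE)
  case (1 g F1 G1 h U)
  have "g \<in> F0" using rgi_invariant_reachable[OF reach] \<open>g \<in> G\<close> unfolding rgi_invariant_def by blast
  then have "d \<le> h d" using le_rgi_h 1(4) by simp
  moreover have "G1 \<union> U \<subset> G" if "h d = d"
  proof -
    \<comment> \<open>By (B) nothing is rescheduled when \<open>d\<close> stays put, so the removal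
      of \<open>g\<close> is a net loss for \<open>G\<close>.\<close>
    have "U = {}" using 1(5) that by (simp add: update_spec_def)
    then show ?thesis using 1(1,3) unfolding rgi_G_def by blast
  qed
  ultimately show ?thesis using 1(6) unfolding order_le_less by auto
qed

lemma rgi_terminates: "\<nexists>s. s 0 = rgi_init F0 \<and> (\<forall>n::nat. step (s n) (s (Suc n)))"
proof
  assume "\<exists>s. s 0 = rgi_init F0 \<and> (\<forall>n::nat. step (s n) (s (Suc n)))"
  then obtain s where s0: "s 0 = rgi_init F0" and s: "\<And>n::nat. step (s n) (s (Suc n))"
    by blast
  have reach: "step\<^sup>*\<^sup>* (rgi_init F0) (s n)" for n
  proof (induction n)
    case 0
    then show ?case by (simp add: s0)
  next
    case (Suc n)
    then show ?case using s by (rule rtranclp.rtrancl_into_rtrancl)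
  qed
  \<comment> \<open>The number of elements strictly above \<open>d\<close> comes first, so that a
    rise of \<open>d\<close> outweighs any growth of \<open>G\<close> caused by the update.\<close>
  let ?R = "measure (\<lambda>d. card {x. d < x}) <*lex*> measure card"
  let ?m = "\<lambda>(F, G, d). (d, G)"
  have "(?m (s (Suc n)), ?m (s n)) \<in> ?R" for n
  proof -
    obtain F G d F' G' d' where eq: "s n = (F, G, d)" "s (Suc n) = (F', G', d')"
      by (metis prod_cases3)
    have "d < d' \<or> (d' = d \<and> G' \<subset> G)"
      using rgi_step_decreases reach[of n] s[of n] by (simp add: eq)
    then show ?thesis
    proof
      assume "d < d'"
      then have "{x. d' < x} \<subset> {x. d < x}" using less_trans by blast
      then show ?thesis by (simp add: eq psubset_card_mono)
    next
      assume "d' = d \<and> G' \<subset> G"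
      then show ?thesis by (simp add: eq psubset_card_mono)
    qed
  qed
  moreover have "wf ?R" by (intro wf_lex_prod wf_measure)
  ultimately show False using wf_no_infinite_down_chainE[of ?R "\<lambda>n. ?m (s n)"] by blast
qed

lemma rgi_result:
  assumes reach: "step\<^sup>*\<^sup>* (rgi_init F0) (F, G, d)" and stop: "\<not> rgi_guard (F, G, d)"
  shows "least_common_fixpoint F0 d"
proof -
  have inv: "rgi_invariant F0 F G d" by (rule rgi_invariant_reachable[OF reach])
  have "f d = d" if f: "f \<in> F0" for f
  proof (cases "d = top")
    case True
    \<comment> \<open>An inflationary function fixes the greatest element, so leaving the loop with
      \<open>G\<close> nonempty is harmless.\<close>
    then show ?thesis using inflationary[OF f] by (metis inflationary_def top_unique)
  next
    case False
    then have "G = {}" using stop by simp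
    \<comment> \<open>With \<open>G\<close> empty, both remaining disjuncts make the witness of
      \<open>f\<close> fix \<open>d\<close>; domination at \<open>e = d\<close> passes this on to
      \<open>f\<close>.\<close>
    then show ?thesis using inv f by (fastforce simp: rgi_invariant_def controlled_def)
  qed
  then show ?thesis using inv by (simp add: least_common_fixpoint_def rgi_invariant_def)
qed

end

theorem theorem2:
  fixes F :: "('a::{finite,order_bot,order_top} \<Rightarrow> 'a) set"
    and friends obviated :: "('a \<Rightarrow> 'a) \<Rightarrow> 'a \<Rightarrow> ('a \<Rightarrow> 'a) list"
    and update :: "('a \<Rightarrow> 'a) set \<Rightarrow> ('a \<Rightarrow> 'a) set \<Rightarrow> ('a \<Rightarrow> 'a) \<Rightarrow> 'a \<Rightarrow> ('a \<Rightarrow> 'a) set"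
  assumes "finite F"
    and "\<And>f. f \<in> F \<Longrightarrow> inflationary f"
    and "\<And>f. f \<in> F \<Longrightarrow> mono f"
    and "\<And>g d. g \<in> F \<Longrightarrow> set (friends g d) \<subseteq> F"
    and "\<And>g d. g \<in> F \<Longrightarrow> set (obviated g d) \<subseteq> F"
    and "friends_condition F friends obviated"
    and "update_correct F friends obviated update"
  shows "(\<nexists>s. s 0 = rgi_init F \<and> (\<forall>n::nat. rgi_step friends obviated update (s n) (s (Suc n)))) \<and>
    (\<forall>F' G d. (rgi_step friends obviated update)\<^sup>*\<^sup>* (rgi_init F) (F', G, d) \<and>
        \<not> rgi_guard (F', G, d) \<longrightarrow> least_common_fixpoint F d)"
proof -
  interpret rgi F friends obviated update
    using assms by unfold_locales auto
  show ?thesis using rgi_terminates rgi_result by blast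
qed

end
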